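(* Let $G$ be a finite bipartite graph with at least one edge and without isolated vertices, and let $M$ be an almost perfect matching of $G$. Then $$V(G)=\sum_{e\in M}V(G\backslash e).$$
   Context: For a graph $G=(V,E)$ with $n=|E|$ edges, the matching polytope $M_G$ is the set of all $w\colon E\to\mathbf R_{\ge 0}$ such that $\sum_{e\ni v}w(e)\le 1$ for all $v\in V$, viewed as a polytope in $\mathbf R^n$, and $V(G)=n!\cdot\operatorname{vol}(M_G)$ (with $V=1$ for a graph with no edges). $G\backslash e$ is obtained from $G$ by deleting the edge $e$ (isolated vertices that arise may be discarded). A matching of $G$ is a set of edges no two of which share a vertex. A matching $M$ is almost perfect if every isolated edge of $G$ (an edge forming a connected component by itself) lies in $M$ and every non-leaf vertex of $G$ is contained in an edge of $M$. *)

theory Defs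
  imports "HOL-Analysis.Analysis"
begin

record 'a ugraph =
  verts :: "'a set"
  edges :: "'a set set"

definition finite_simple_graph :: "'a ugraph \<Rightarrow> bool" where
  "finite_simple_graph G \<longleftrightarrow>
     finite (verts G) \<and> (\<forall>e\<in>edges G. e \<subseteq> verts G \<and> card e = 2)"

definition bipartite :: "'a ugraph \<Rightarrow> bool" where
  "bipartite G \<longleftrightarrow>
     (\<exists>A B. A \<union> B = verts G \<and> A \<inter> B = {} \<and>
            (\<forall>e\<in>edges G. \<exists>a\<in>A. \<exists>b\<in>B. e = {a, b}))"

definition incident_edges :: "'a ugraph \<Rightarrow> 'a \<Rightarrow> 'a set set" where
  "incident_edges G v = {e \<in> edges G. v \<in> e}"

definition degree :: "'a ugraph \<Rightarrow> 'a \<Rightarrow> nat" where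
  "degree G v = card (incident_edges G v)"

definition isolated_vertex :: "'a ugraph \<Rightarrow> 'a \<Rightarrow> bool" where
  "isolated_vertex G v \<longleftrightarrow> v \<in> verts G \<and> degree G v = 0"

definition leaf :: "'a ugraph \<Rightarrow> 'a \<Rightarrow> bool" where
  "leaf G v \<longleftrightarrow> v \<in> verts G \<and> degree G v = 1"

definition adjacency :: "'a ugraph \<Rightarrow> ('a \<times> 'a) set" where
  "adjacency G = {(u, v). {u, v} \<in> edges G}"

definition graph_components :: "'a ugraph \<Rightarrow> 'a set set" where
  "graph_components G = (\<lambda>v. (adjacency G)\<^sup>* `` {v}) ` verts G"

text \<open>An edge is the set of its two ends, so that it forms a connected component
  by itself precisely when it is the vertex set of one: in a simple graph there is
  no second edge on the same two ends.\<close>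

definition isolated_edge :: "'a ugraph \<Rightarrow> 'a set \<Rightarrow> bool" where
  "isolated_edge G e \<longleftrightarrow> e \<in> edges G \<and> e \<in> graph_components G"

definition matching :: "'a ugraph \<Rightarrow> 'a set set \<Rightarrow> bool" where
  "matching G M \<longleftrightarrow> M \<subseteq> edges G \<and> (\<forall>e\<in>M. \<forall>f\<in>M. e \<noteq> f \<longrightarrow> e \<inter> f = {})"

definition almost_perfect_matching :: "'a ugraph \<Rightarrow> 'a set set \<Rightarrow> bool" where
  "almost_perfect_matching G M \<longleftrightarrow>
     matching G M \<and>
     (\<forall>e. isolated_edge G e \<longrightarrow> e \<in> M) \<and>
     (\<forall>v\<in>verts G. \<not> leaf G v \<longrightarrow> (\<exists>e\<in>M. v \<in> e))"

text \<open>Vertices that become isolated are kept; they only contribute the void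
  constraint \<open>0 \<le> 1\<close> to the matching polytope.\<close>

definition delete_edge :: "'a ugraph \<Rightarrow> 'a set \<Rightarrow> 'a ugraph" where
  "delete_edge G e = G\<lparr>edges := edges G - {e}\<rparr>"

text \<open>The space \<open>\<real>\<^sup>E\<close> is modelled by the extensional functions on the edge set,
  with the product of the Lebesgue--Borel measures as volume.\<close>

definition matching_polytope :: "'a ugraph \<Rightarrow> ('a set \<Rightarrow> real) set" where
  "matching_polytope G =
     {w \<in> edges G \<rightarrow>\<^sub>E {0..}. \<forall>v\<in>verts G. (\<Sum>e\<in>incident_edges G v. w e) \<le> 1}"

definition normalized_volume :: "'a ugraph \<Rightarrow> real" where
  "normalized_volume G =
     fact (card (edges G)) *
     measure (Pi\<^sub>M (edges G) (\<lambda>_. lborel)) (matching_polytope G)"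

lemma normalized_volume_no_edges:
  assumes "edges G = {}"
  shows "normalized_volume G = 1"
proof -
  have "matching_polytope G = {\<lambda>_. undefined}"
    using assms by (auto simp: matching_polytope_def incident_edges_def)
  then show ?thesis
    using assms
    by (simp add: normalized_volume_def PiM_empty measure_def emeasure_count_space)
qed

end

theory Submission
  imports Defs
begin

text \<open>
  Let \<open>n\<close> be the number of edges of \<open>G\<close>, and \<open>\<chi>\<close> the indicator function of \<open>M\<close>, a point of the
  matching polytope. The idea is to cut the polytope into pyramids with apex \<open>\<chi>\<close>, one over each
  facet that misses \<open>\<chi>\<close>.

  The constraint at a vertex covered by \<open>M\<close> holds with equality at \<open>\<chi>\<close>. The constraint at an
  uncovered vertex \<open>v\<close> is redundant: as \<open>M\<close> is almost perfect, \<open>v\<close> is a leaf, and the other end of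
  its only edge is covered, since otherwise that edge would be an isolated edge outside \<open>M\<close>. This is
  lemma \<open>matching_polytope_covered\<close>. So the facets that miss \<open>\<chi>\<close> are among the faces
  \<open>w e = 0\<close> for \<open>e \<in> M\<close>. Each of these is the matching polytope of \<open>G\<close> without \<open>e\<close>, and lies at
  distance \<open>1\<close> from \<open>\<chi>\<close> because \<open>\<chi> e = 1\<close>. The pyramid over it therefore has volume \<open>1 / n\<close>
  times the volume of its base (lemma \<open>emeasure_pyramid\<close>), and multiplying by \<open>n!\<close> turns the sum of
  these volumes into the asserted sum of normalized volumes.

  A point of the pyramid over the face \<open>w e = 0\<close> has the form \<open>w = s \<chi> + (1 - s) y\<close> with
  \<open>y e = 0\<close> and \<open>y \<ge> 0\<close>. Then \<open>s = w e\<close> and \<open>w f \<ge> s\<close> for all \<open>f \<in> M\<close>, so the pyramid consists of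
  those points of the polytope whose smallest coordinate in \<open>M\<close> is the one at \<open>e\<close>. In this
  description it is evident that the pyramids cover the polytope and that two of them meet only
  inside a hyperplane \<open>w e = w f\<close>, a null set
  (lemma \<open>emeasure_matching_polytope_eq_sum_pyramids\<close>). Their volumes come from Fubini's theorem:
  the slice \<open>w e = s\<close> is the base shrunk by the factor \<open>1 - s\<close> (lemma \<open>pyramid_slice\<close>), and
  \<open>(1 - s)^(n - 1)\<close> has integral \<open>1 / n\<close> over \<open>[0, 1]\<close>.
\<close>

section \<open>Finite products of Lebesgue measure\<close>

interpretation lborel_product: product_sigma_finite "\<lambda>_. lborel :: real measure"
  by standard

text \<open>By induction on the index set, each coordinate contributing one factor \<open>r\<close> through the affine
  substitution on the real line.\<close>

lemma nn_integral_PiM_lborel_affine: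
  fixes c :: "'i \<Rightarrow> real"
  assumes "finite I" and "0 < r" and "f \<in> borel_measurable (Pi\<^sub>M I (\<lambda>_. lborel))"
  shows "(\<integral>\<^sup>+ x. f x \<partial>Pi\<^sub>M I (\<lambda>_. lborel)) =
    ennreal (r ^ card I) * (\<integral>\<^sup>+ x. f (\<lambda>i\<in>I. c i + r * x i) \<partial>Pi\<^sub>M I (\<lambda>_. lborel))"
  using assms(1,3)
proof (induction I arbitrary: f rule: finite_induct)
  case empty
  then show ?case
    by (simp add: lborel_product.nn_integral_empty restrict_def del: nn_integral_const)
next
  case (insert i I)
  let ?L = "\<lambda>_. lborel :: real measure"
  note [measurable] = insert.prems
  have [measurable]: "(\<lambda>x. f (x(i := y))) \<in> borel_measurable (Pi\<^sub>M I ?L)" for y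
    using insert.hyps
    by (intro measurable_compose[OF _ insert.prems] measurable_fun_upd[where J=I]) auto
  have upd [measurable]: "(\<lambda>(y, x). (x :: 'i \<Rightarrow> real)(i := y)) \<in> borel \<Otimes>\<^sub>M Pi\<^sub>M I ?L \<rightarrow>\<^sub>M Pi\<^sub>M (insert i I) ?L"
    by (rule measurable_split_conv[THEN iffD2], rule measurable_fun_upd[where J=I]) auto
  let ?g = "\<lambda>y. \<integral>\<^sup>+ x. f ((\<lambda>j\<in>I. c j + r * x j)(i := y)) \<partial>Pi\<^sub>M I ?L"
  have aff: "(\<lambda>x. \<lambda>j\<in>I. c j + r * x j) \<in> Pi\<^sub>M I ?L \<rightarrow>\<^sub>M Pi\<^sub>M I ?L"
    by (intro measurable_restrict) measurable
  have aff': "(\<lambda>x. \<lambda>j\<in>insert i I. c j + r * x j) \<in> Pi\<^sub>M (insert i I) ?L \<rightarrow>\<^sub>M Pi\<^sub>M (insert i I) ?L"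
    by (intro measurable_restrict) measurable
  have [measurable]: "?g \<in> borel_measurable borel"
  proof -
    interpret sigma_finite_measure "Pi\<^sub>M I ?L"
      using insert.hyps by (intro lborel_product.sigma_finite) auto
    have "(\<lambda>p. (\<lambda>(y, x). x(i := y)) (fst p, \<lambda>j\<in>I. c j + r * snd p j))
        \<in> borel \<Otimes>\<^sub>M Pi\<^sub>M I ?L \<rightarrow>\<^sub>M Pi\<^sub>M (insert i I) ?L"
      by (intro measurable_compose[OF _ upd] measurable_Pair measurable_fst
          measurable_compose[OF measurable_snd aff])
    from measurable_compose[OF this insert.prems] show ?thesis
      by (intro borel_measurable_nn_integral) (simp add: case_prod_beta)
  qed
  have "(\<integral>\<^sup>+ x. f x \<partial>Pi\<^sub>M (insert i I) ?L) = (\<integral>\<^sup>+ y. \<integral>\<^sup>+ x. f (x(i := y)) \<partial>Pi\<^sub>M I ?L \<partial>lborel)"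
    using insert by (intro lborel_product.product_nn_integral_insert_rev) auto
  also have "\<dots> = (\<integral>\<^sup>+ y. ennreal (r ^ card I) * ?g y \<partial>lborel)"
    by (intro nn_integral_cong insert.IH) measurable
  also have "\<dots> = ennreal (r ^ card I) * (\<integral>\<^sup>+ y. ?g y \<partial>lborel)"
    by (rule nn_integral_cmult) simp
  also have "(\<integral>\<^sup>+ y. ?g y \<partial>lborel) = ennreal r * (\<integral>\<^sup>+ y. ?g (c i + r * y) \<partial>lborel)"
    using \<open>0 < r\<close> nn_integral_real_affine[of ?g r "c i"] by simp
  also have "(\<integral>\<^sup>+ y. ?g (c i + r * y) \<partial>lborel)
      = (\<integral>\<^sup>+ y. \<integral>\<^sup>+ x. f (\<lambda>j\<in>insert i I. c j + r * (x(i := y)) j) \<partial>Pi\<^sub>M I ?L \<partial>lborel)"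
    using insert.hyps by (intro nn_integral_cong arg_cong[where f=f]) (auto simp: fun_eq_iff)
  also have "\<dots> = (\<integral>\<^sup>+ x. f (\<lambda>j\<in>insert i I. c j + r * x j) \<partial>Pi\<^sub>M (insert i I) ?L)"
    using insert.hyps
    by (intro lborel_product.product_nn_integral_insert_rev[symmetric]
        measurable_compose[OF aff' insert.prems])
  finally have "(\<integral>\<^sup>+ x. f x \<partial>Pi\<^sub>M (insert i I) ?L) = ennreal (r ^ card I) * (ennreal r *
      (\<integral>\<^sup>+ x. f (\<lambda>j\<in>insert i I. c j + r * x j) \<partial>Pi\<^sub>M (insert i I) ?L))" .
  moreover have "ennreal (r ^ card (insert i I)) = ennreal (r ^ card I) * ennreal r"
    using insert.hyps \<open>0 < r\<close> by (simp add: ennreal_mult mult.commute)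
  ultimately show ?case by (simp only: mult.assoc)
qed

text \<open>A line parallel to the \<open>e\<close>-axis meets the hyperplane \<open>w e = w f\<close> in a single point.\<close>

lemma AE_PiM_lborel_neq:
  assumes "finite I" "e \<in> I" "f \<in> I" "e \<noteq> f"
  shows "AE w in Pi\<^sub>M I (\<lambda>_. lborel :: real measure). w e \<noteq> w f"
proof -
  let ?L = "\<lambda>_. lborel :: real measure"
  let ?D = "{w \<in> space (Pi\<^sub>M I ?L). w e = w f}"
  have I: "I = insert e (I - {e})" using assms by auto
  have D [measurable]: "?D \<in> sets (Pi\<^sub>M I ?L)"
    using assms by measurable
  have "emeasure (Pi\<^sub>M I ?L) ?D = (\<integral>\<^sup>+ w. indicator ?D w \<partial>Pi\<^sub>M (insert e (I - {e})) ?L)"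
    using D I by simp
  also have "\<dots> = (\<integral>\<^sup>+ w. \<integral>\<^sup>+ y. indicator ?D (w(e := y)) \<partial>lborel \<partial>Pi\<^sub>M (I - {e}) ?L)"
    using assms D I by (intro lborel_product.product_nn_integral_insert) auto
  also have "\<dots> \<le> (\<integral>\<^sup>+ w. \<integral>\<^sup>+ y. indicator {w f} y \<partial>lborel \<partial>Pi\<^sub>M (I - {e}) ?L)"
    using assms by (intro nn_integral_mono) (auto simp: indicator_def)
  also have "\<dots> = 0" by simp
  finally have "emeasure (Pi\<^sub>M I ?L) ?D = 0" by simp
  then show ?thesis
    by (intro AE_I[OF _ _ D]) auto
qed

lemma nn_integral_one_minus_power:
  "(\<integral>\<^sup>+ s. ennreal ((1 - s) ^ k) * indicator {0..1::real} s \<partial>lborel) = ennreal (1 / real (Suc k))"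
proof -
  have "(\<integral>\<^sup>+ s. ennreal ((1 - s) ^ k) * indicator {0..1::real} s \<partial>lborel)
      = ennreal (- ((1 - 1) ^ Suc k / real (Suc k)) - (- ((1 - 0) ^ Suc k / real (Suc k))))"
    by (rule nn_integral_FTC_Icc)
      (auto intro!: derivative_eq_intros simp del: power_Suc of_nat_Suc)
  then show ?thesis by simp
qed

section \<open>Almost perfect matchings and redundant constraints\<close>

lemma isolated_edge_if_leaves:
  assumes G: "finite_simple_graph G"
    and f: "f \<in> edges G" "f = {u, v}"
    and "leaf G u" "leaf G v"
  shows "isolated_edge G f"
proof -
  have only: "g = f" if "g \<in> edges G" "x \<in> g" "x = u \<or> x = v" for g x
  proof -
    have "card (incident_edges G x) = 1"
      using that assms by (auto simp: leaf_def degree_def)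
    then obtain h where "incident_edges G x = {h}"
      by (auto simp: card_1_singleton_iff)
    moreover have "g \<in> incident_edges G x" "f \<in> incident_edges G x"
      unfolding incident_edges_def using that f by blast+
    ultimately show ?thesis by simp
  qed
  have "(adjacency G)\<^sup>* `` {u} = f"
  proof (intro equalityI subsetI)
    fix x assume "x \<in> (adjacency G)\<^sup>* `` {u}"
    then have "(u, x) \<in> (adjacency G)\<^sup>*" by simp
    then show "x \<in> f"
    proof induction
      case base then show ?case using f by simp
    next
      case (step y z)
      then have "{y, z} = f" using only[of "{y, z}" y] f by (auto simp: adjacency_def)
      then show ?case by auto
    qed
  next
    fix x assume "x \<in> f"
    then show "x \<in> (adjacency G)\<^sup>* `` {u}"
      using f by (auto simp: adjacency_def)
  qed
  then have "f \<in> graph_components G"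
    using \<open>leaf G u\<close> by (auto simp: graph_components_def leaf_def)
  then show ?thesis using f by (simp add: isolated_edge_def)
qed

lemma finite_edges:
  assumes "finite_simple_graph G" shows "finite (edges G)"
  using assms
  by (intro finite_subset[of "edges G" "Pow (verts G)"]) (auto simp: finite_simple_graph_def)

text \<open>The only edge at an uncovered vertex cannot have a second leaf as its other end: it would be
  isolated, hence in \<open>M\<close>.\<close>

lemma uncovered_vertex_neighbour:
  assumes G: "finite_simple_graph G" and M: "almost_perfect_matching G M"
    and v: "v \<in> verts G" "v \<notin> \<Union>M"
  obtains f u where "incident_edges G v = {f}" "u \<in> f" "u \<in> \<Union>M"
proof -
  have lv: "leaf G v" using M v by (auto simp: almost_perfect_matching_def)
  then obtain f where f: "incident_edges G v = {f}"
    by (auto simp: leaf_def degree_def card_1_singleton_iff)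
  then have fE: "f \<in> edges G" "v \<in> f" by (auto simp: incident_edges_def)
  then obtain u where u: "f = {u, v}"
    using G by (fastforce simp: finite_simple_graph_def card_2_iff doubleton_eq_iff)
  have "u \<in> verts G" using G fE u by (auto simp: finite_simple_graph_def)
  moreover have "\<not> leaf G u"
  proof
    assume "leaf G u"
    with isolated_edge_if_leaves[OF G fE(1) u] lv M have "f \<in> M"
      by (auto simp: almost_perfect_matching_def)
    with v fE show False by auto
  qed
  ultimately have "u \<in> \<Union>M" using M by (auto simp: almost_perfect_matching_def)
  with that f u show ?thesis by auto
qed

text \<open>At an uncovered vertex the sum of weights is dominated by that at its neighbour, which is covered.
  In a spanning subgraph \<open>H\<close> the incident edges of the former are still among those of the
  latter, so that the covered vertices of
  \<open>G\<close> also suffice for \<open>H\<close>; this is needed for \<open>G\<close> itself and for \<open>G\<close> without an edge of \<open>M\<close>.\<close>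

lemma matching_polytope_covered:
  assumes G: "finite_simple_graph G" and M: "almost_perfect_matching G M"
    and H: "verts H = verts G" "edges H \<subseteq> edges G"
  shows "matching_polytope H =
    {w \<in> edges H \<rightarrow>\<^sub>E {0..}. \<forall>v\<in>\<Union>M. (\<Sum>e\<in>incident_edges H v. w e) \<le> 1}"
proof -
  have MV: "\<Union>M \<subseteq> verts G"
    using G M by (auto simp: almost_perfect_matching_def matching_def finite_simple_graph_def)
  have fin: "finite (incident_edges H x)" for x
    using finite_subset[OF H(2) finite_edges[OF G]] by (auto simp: incident_edges_def)
  have "(\<Sum>e\<in>incident_edges H v. w e) \<le> 1"
    if w: "w \<in> edges H \<rightarrow>\<^sub>E {0..}"
      and le: "\<forall>v\<in>\<Union>M. (\<Sum>e\<in>incident_edges H v. w e) \<le> 1"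
      and v: "v \<in> verts G" for w :: "'a set \<Rightarrow> real" and v
  proof (cases "v \<in> \<Union>M")
    case True
    then show ?thesis using le by blast
  next
    case False
    from uncovered_vertex_neighbour[OF G M v False]
    obtain f u where fu: "incident_edges G v = {f}" "u \<in> f" "u \<in> \<Union>M" .
    then have "incident_edges H v \<subseteq> incident_edges H u"
      using H by (auto simp: incident_edges_def)
    then have "(\<Sum>e\<in>incident_edges H v. w e) \<le> (\<Sum>e\<in>incident_edges H u. w e)"
      using w by (intro sum_mono2 fin) (auto simp: incident_edges_def)
    also have "\<dots> \<le> 1" using le fu by blast
    finally show ?thesis .
  qed
  then show ?thesis
    using MV H by (auto simp: matching_polytope_def)
qed

section \<open>Measurability and boundedness\<close>

lemma matching_polytope_sets:
  assumes "finite_simple_graph G"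
  shows "matching_polytope G \<in> sets (Pi\<^sub>M (edges G) (\<lambda>_. lborel))"
proof -
  have [measurable]: "finite (edges G)" "finite (verts G)"
    using assms finite_edges by (auto simp: finite_simple_graph_def)
  have eq: "matching_polytope G = {w \<in> space (Pi\<^sub>M (edges G) (\<lambda>_. lborel)).
      (\<forall>e\<in>edges G. 0 \<le> w e) \<and> (\<forall>v\<in>verts G. (\<Sum>e\<in>incident_edges G v. w e) \<le> 1)}"
    by (auto simp: matching_polytope_def space_PiM PiE_def Pi_def)
  have [measurable]: "(\<lambda>w. \<Sum>e\<in>incident_edges G v. w e) \<in> borel_measurable (Pi\<^sub>M (edges G) (\<lambda>_. lborel))" for v
    by (intro borel_measurable_sum) (auto simp: incident_edges_def)
  show ?thesis unfolding eq by measurable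
qed

lemma matching_polytope_le_1:
  assumes G: "finite_simple_graph G" and w: "w \<in> matching_polytope G" and e: "e \<in> edges G"
  shows "w e \<le> 1"
proof -
  obtain v where v: "v \<in> e" "v \<in> verts G"
    using G e by (fastforce simp: finite_simple_graph_def card_2_iff)
  have "w e \<le> (\<Sum>f\<in>incident_edges G v. w f)"
    using w v e finite_edges[OF G]
    by (intro member_le_sum) (auto simp: incident_edges_def matching_polytope_def)
  also have "\<dots> \<le> 1" using w v by (auto simp: matching_polytope_def)
  finally show ?thesis .
qed

lemma emeasure_matching_polytope_finite:
  assumes G: "finite_simple_graph G"
  shows "emeasure (Pi\<^sub>M (edges G) (\<lambda>_. lborel)) (matching_polytope G) \<noteq> \<infinity>"
proof -
  let ?L = "Pi\<^sub>M (edges G) (\<lambda>_. lborel :: real measure)"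
  have "emeasure ?L (matching_polytope G) \<le> emeasure ?L (edges G \<rightarrow>\<^sub>E {0..1})"
  proof (rule emeasure_mono)
    show "matching_polytope G \<subseteq> edges G \<rightarrow>\<^sub>E {0..1}"
    proof
      fix w assume w: "w \<in> matching_polytope G"
      then have "w \<in> edges G \<rightarrow>\<^sub>E {0..}" by (simp add: matching_polytope_def)
      with matching_polytope_le_1[OF G w] show "w \<in> edges G \<rightarrow>\<^sub>E {0..1}"
        by (simp add: PiE_iff)
    qed
    show "(edges G \<rightarrow>\<^sub>E {0..1}) \<in> sets ?L"
      using finite_edges[OF G] by (intro sets_PiM_I_finite) auto
  qed
  also have "\<dots> = 1"
    using finite_edges[OF G] by (subst lborel_product.emeasure_PiM) auto
  finally show ?thesis by (auto simp: top_unique)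
qed

section \<open>Pyramids with apex at the matching\<close>

text \<open>The convex hull of the indicator function of \<open>M\<close> and the face \<open>w e = 0\<close>, described by
  inequalities: the coefficient of the apex is \<open>w e\<close>, and subtracting it from the coordinates in
  \<open>M\<close> has to leave them nonnegative.\<close>

definition pyramid :: "'a ugraph \<Rightarrow> 'a set set \<Rightarrow> 'a set \<Rightarrow> ('a set \<Rightarrow> real) set" where
  "pyramid G M e = {w \<in> matching_polytope G. \<forall>f\<in>M. w e \<le> w f}"

lemma pyramid_sets:
  assumes G: "finite_simple_graph G" and "M \<subseteq> edges G" "e \<in> M"
  shows "pyramid G M e \<in> sets (Pi\<^sub>M (edges G) (\<lambda>_. lborel))"
proof -
  let ?L = "Pi\<^sub>M (edges G) (\<lambda>_. lborel :: real measure)"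
  have fin: "finite M" using assms finite_edges finite_subset by blast
  have [measurable]: "(\<lambda>w. w f) \<in> borel_measurable ?L" if "f \<in> M" for f
    using that assms(2) by auto
  have eq: "pyramid G M e = matching_polytope G \<inter> {w \<in> space ?L. \<forall>f\<in>M. w e \<le> w f}"
    using sets.sets_into_space[OF matching_polytope_sets[OF G]]
    by (auto simp: pyramid_def)
  have "{w \<in> space ?L. \<forall>f\<in>M. w e \<le> w f} \<in> sets ?L"
    using fin assms by (intro sets.sets_Collect_finite_All borel_measurable_le) auto
  then show ?thesis unfolding eq using matching_polytope_sets[OF G] by blast
qed

lemma finite_simple_graph_delete_edge:
  "finite_simple_graph G \<Longrightarrow> finite_simple_graph (delete_edge G e)"
  by (auto simp: finite_simple_graph_def delete_edge_def)

text \<open>The point in question is \<open>s \<chi> + (1 - s) y\<close> with \<open>\<chi>\<close> the indicator function of \<open>M\<close> and \<open>y e = 0\<close>.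
  A covered vertex has exactly one incident edge in \<open>M\<close>, so its sum of weights is \<open>s + (1 - s) a\<close>,
  where \<open>a\<close> is its sum for \<open>y\<close>, and one of them is at most \<open>1\<close> exactly when the other is.\<close>

lemma pyramid_slice:
  fixes y :: "'a set \<Rightarrow> real"
  assumes G: "finite_simple_graph G" and M: "almost_perfect_matching G M" and e: "e \<in> M"
    and s: "0 \<le> s" "s < 1" and y: "y \<in> extensional (edges G - {e})"
  shows "(\<lambda>f\<in>edges G - {e}. (if f \<in> M then s else 0) + (1 - s) * y f)(e := s) \<in> pyramid G M e
    \<longleftrightarrow> y \<in> matching_polytope (delete_edge G e)"
    (is "?w \<in> _ \<longleftrightarrow> _")
proof -
  let ?H = "delete_edge G e"
  have ME: "M \<subseteq> edges G"
    using M by (auto simp: almost_perfect_matching_def matching_def)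
  have disj: "f = g" if "f \<in> M" "g \<in> M" "v \<in> f" "v \<in> g" for f g v
    using M that by (auto simp: almost_perfect_matching_def matching_def)
  have H [simp]: "verts ?H = verts G" "edges ?H = edges G - {e}"
    by (simp_all add: delete_edge_def)
  have pos: "0 \<le> (1 - s) * a \<longleftrightarrow> 0 \<le> a" for a
    using s by (simp add: zero_le_mult_iff)
  \<comment> \<open>Giving \<open>y\<close> the value \<open>0\<close> at \<open>e\<close> makes the formula uniform over all edges, \<open>e\<close> included.\<close>
  have w: "?w f = (if f \<in> M then s else 0) + (1 - s) * (y(e := 0)) f" if "f \<in> edges G" for f
    using that e by auto
  have sum: "(\<Sum>f\<in>incident_edges G v. ?w f) = s + (1 - s) * (\<Sum>f\<in>incident_edges ?H v. y f)"
    if v: "v \<in> \<Union>M" for v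
  proof -
    have fin: "finite (incident_edges G v)"
      using finite_edges[OF G] by (simp add: incident_edges_def)
    from v obtain g where g: "g \<in> M" "v \<in> g" by blast
    have gI: "incident_edges G v \<inter> M = {g}"
      using g ME disj by (auto simp: incident_edges_def)
    have "(\<Sum>f\<in>incident_edges G v. ?w f) = (\<Sum>f\<in>incident_edges G v. (if f \<in> M then s else 0) + (1 - s) * (y(e := 0)) f)"
      using w by (intro sum.cong) (auto simp: incident_edges_def)
    also have "\<dots> = (\<Sum>f\<in>incident_edges G v. if f \<in> M then s else 0)
        + (1 - s) * (\<Sum>f\<in>incident_edges G v. (y(e := 0)) f)"
      by (simp only: sum.distrib sum_distrib_left)
    also have "(\<Sum>f\<in>incident_edges G v. if f \<in> M then s else 0) = s"
      using fin gI by (simp add: sum.inter_restrict[symmetric])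
    also have "(\<Sum>f\<in>incident_edges G v. (y(e := 0)) f) = (\<Sum>f\<in>incident_edges ?H v. y f)"
      using fin by (intro sum.mono_neutral_cong_right) (auto simp: incident_edges_def)
    finally show ?thesis .
  qed
  have sum_le: "(\<Sum>f\<in>incident_edges G v. ?w f) \<le> 1 \<longleftrightarrow> (\<Sum>f\<in>incident_edges ?H v. y f) \<le> 1"
    if "v \<in> \<Union>M" for v
  proof -
    have "s + (1 - s) * a \<le> 1 \<longleftrightarrow> (1 - s) * a \<le> (1 - s) * 1" for a by auto
    then show ?thesis
      unfolding sum[OF that] using s by (simp only: mult_le_cancel_left_pos)
  qed
  have ext: "?w \<in> extensional (edges G)"
    using e ME by (auto simp: extensional_def)
  have nonneg: "(\<forall>f\<in>edges G. 0 \<le> ?w f) \<and> (\<forall>f\<in>M. ?w e \<le> ?w f) \<longleftrightarrow> (\<forall>f\<in>edges G - {e}. 0 \<le> y f)"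
  proof (intro iffI conjI ballI)
    fix f assume *: "(\<forall>f\<in>edges G. 0 \<le> ?w f) \<and> (\<forall>f\<in>M. ?w e \<le> ?w f)" and f: "f \<in> edges G - {e}"
    show "0 \<le> y f"
    proof (cases "f \<in> M")
      case True
      with * have "?w e \<le> ?w f" by blast
      with True f pos show ?thesis by simp
    next
      case False
      from * f have "0 \<le> ?w f" by blast
      with False f pos show ?thesis by simp
    qed
  next
    fix f assume *: "\<forall>f\<in>edges G - {e}. 0 \<le> y f" and f: "f \<in> edges G"
    show "0 \<le> ?w f" using * f s by auto
  next
    fix f assume *: "\<forall>f\<in>edges G - {e}. 0 \<le> y f" and f: "f \<in> M"
    show "?w e \<le> ?w f" using * f s ME by auto
  qed
  have pyr: "w \<in> pyramid G M e \<longleftrightarrow> ((\<forall>f\<in>edges G. 0 \<le> w f) \<and> (\<forall>f\<in>M. w e \<le> w f)) \<and>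
      (\<forall>v\<in>\<Union>M. (\<Sum>f\<in>incident_edges G v. w f) \<le> 1)"
    if "w \<in> extensional (edges G)" for w
    using that matching_polytope_covered[OF G M refl order_refl]
    by (auto simp: pyramid_def PiE_iff)
  have face: "y \<in> matching_polytope ?H \<longleftrightarrow> (\<forall>f\<in>edges G - {e}. 0 \<le> y f) \<and>
      (\<forall>v\<in>\<Union>M. (\<Sum>f\<in>incident_edges ?H v. y f) \<le> 1)"
    using y matching_polytope_covered[OF G M, of ?H] by (auto simp: PiE_iff)
  have "(\<forall>v\<in>\<Union>M. (\<Sum>f\<in>incident_edges G v. ?w f) \<le> 1) \<longleftrightarrow>
      (\<forall>v\<in>\<Union>M. (\<Sum>f\<in>incident_edges ?H v. y f) \<le> 1)"
    by (rule ball_cong[OF refl sum_le])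
  then show ?thesis
    by (simp only: pyr[OF ext] face nonneg)
qed

text \<open>The volume of a pyramid of height \<open>1\<close>, by Fubini's theorem with the coordinate at \<open>e\<close> integrated
  last: the slices are homothetic to the base, by a factor that decreases linearly to \<open>0\<close>.\<close>

lemma emeasure_pyramid:
  assumes G: "finite_simple_graph G" and M: "almost_perfect_matching G M" and e: "e \<in> M"
  shows "emeasure (Pi\<^sub>M (edges G) (\<lambda>_. lborel)) (pyramid G M e) =
    ennreal (1 / real (card (edges G))) *
      emeasure (Pi\<^sub>M (edges G - {e}) (\<lambda>_. lborel)) (matching_polytope (delete_edge G e))"
proof -
  let ?L = "\<lambda>I. Pi\<^sub>M I (\<lambda>_. lborel :: real measure)"
  let ?E = "edges G - {e}" and ?P = "pyramid G M e"
  define V where "V = emeasure (?L ?E) (matching_polytope (delete_edge G e))"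
  have ME: "M \<subseteq> edges G"
    using M by (auto simp: almost_perfect_matching_def matching_def)
  have E: "edges G = insert e ?E" "finite ?E" "e \<notin> ?E"
    using e ME finite_edges[OF G] by auto
  have Pset: "?P \<in> sets (?L (edges G))" by (rule pyramid_sets[OF G ME e])
  have Fset: "matching_polytope (delete_edge G e) \<in> sets (?L ?E)"
    using matching_polytope_sets[OF finite_simple_graph_delete_edge[OF G], of e]
    by (simp add: delete_edge_def)
  \<comment> \<open>At \<open>s = 1\<close> the substitution by \<open>y\<close> degenerates, but a single height does not affect the
    integral.\<close>
  have slice: "(\<integral>\<^sup>+ x. indicator ?P (x(e := s)) \<partial>?L ?E) = ennreal ((1 - s) ^ card ?E) * V * indicator {0..1} s"
    if "s \<noteq> 1" for s
  proof (cases "0 \<le> s \<and> s < 1")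
    case True
    have m: "(\<lambda>x. x(e := s)) \<in> ?L ?E \<rightarrow>\<^sub>M ?L (edges G)"
      using E by (intro measurable_fun_upd[where J="?E"]) auto
    have "(\<integral>\<^sup>+ x. indicator ?P (x(e := s)) \<partial>?L ?E) = ennreal ((1 - s) ^ card ?E) *
        (\<integral>\<^sup>+ y. indicator ?P ((\<lambda>f\<in>?E. (if f \<in> M then s else 0) + (1 - s) * y f)(e := s)) \<partial>?L ?E)"
      using E True Pset
      by (intro nn_integral_PiM_lborel_affine measurable_compose[OF m]) auto
    also have "(\<integral>\<^sup>+ y. indicator ?P ((\<lambda>f\<in>?E. (if f \<in> M then s else 0) + (1 - s) * y f)(e := s)) \<partial>?L ?E)
        = (\<integral>\<^sup>+ y. indicator (matching_polytope (delete_edge G e)) y \<partial>?L ?E)"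
      using True pyramid_slice[OF G M e]
      by (intro nn_integral_cong) (simp add: indicator_def space_PiM PiE_def)
    also have "\<dots> = V" using Fset by (simp add: V_def)
    finally show ?thesis using True by (simp del: fun_upd_apply)
  next
    case False
    have "x(e := s) \<notin> ?P" for x
    proof
      assume "x(e := s) \<in> ?P"
      then have "x(e := s) \<in> matching_polytope G" by (simp add: pyramid_def)
      moreover from this have "x(e := s) \<in> edges G \<rightarrow>\<^sub>E {0..}"
        by (simp add: matching_polytope_def)
      moreover have "e \<in> edges G" using e ME by blast
      ultimately have "(x(e := s)) e \<le> 1" "0 \<le> (x(e := s)) e"
        using matching_polytope_le_1[OF G] by (blast, metis PiE_mem atLeast_iff)
      then have "s \<le> 1" "0 \<le> s" by simp_all
      with False that show False by auto
    qed
    with False that show ?thesis by (auto simp: indicator_def simp del: fun_upd_apply)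
  qed
  have "emeasure (?L (edges G)) ?P = (\<integral>\<^sup>+ w. indicator ?P w \<partial>?L (insert e ?E))"
    using Pset E(1) by simp
  also have "\<dots> = (\<integral>\<^sup>+ s. \<integral>\<^sup>+ x. indicator ?P (x(e := s)) \<partial>?L ?E \<partial>lborel)"
    using E Pset by (intro lborel_product.product_nn_integral_insert_rev) auto
  also have "\<dots> = (\<integral>\<^sup>+ s. V * (ennreal ((1 - s) ^ card ?E) * indicator {0..1} s) \<partial>lborel)"
    using slice AE_lborel_singleton[of 1]
    by (intro nn_integral_cong_AE) (auto simp: mult_ac)
  also have "\<dots> = V * ennreal (1 / real (Suc (card ?E)))"
    by (subst nn_integral_cmult) (auto simp: nn_integral_one_minus_power)
  also have "Suc (card ?E) = card (edges G)"
    using E by (metis card_insert_disjoint)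
  finally show ?thesis by (simp add: V_def mult.commute)
qed

text \<open>Almost every point has pairwise distinct coordinates in \<open>M\<close>, so exactly one of them is the
  smallest.\<close>

lemma emeasure_matching_polytope_eq_sum_pyramids:
  assumes G: "finite_simple_graph G" and M: "M \<subseteq> edges G" "M \<noteq> {}"
  shows "emeasure (Pi\<^sub>M (edges G) (\<lambda>_. lborel)) (matching_polytope G) =
    (\<Sum>e\<in>M. emeasure (Pi\<^sub>M (edges G) (\<lambda>_. lborel)) (pyramid G M e))"
proof -
  let ?L = "Pi\<^sub>M (edges G) (\<lambda>_. lborel :: real measure)"
  have fin: "finite M" using M finite_edges[OF G] finite_subset by blast
  have "AE w in ?L. \<forall>e\<in>M. \<forall>f\<in>M. e \<noteq> f \<longrightarrow> w e \<noteq> w f"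
    using fin M AE_PiM_lborel_neq[OF finite_edges[OF G]]
    by (intro AE_finite_allI) (auto simp: subset_iff)
  then have AE: "AE w in ?L. indicator (matching_polytope G) w = (\<Sum>e\<in>M. indicator (pyramid G M e) w :: ennreal)"
  proof (rule AE_mp, intro AE_I2 impI)
    fix w :: "'a set \<Rightarrow> real"
    assume inj: "\<forall>e\<in>M. \<forall>f\<in>M. e \<noteq> f \<longrightarrow> w e \<noteq> w f"
    obtain e where e: "e \<in> M" "\<forall>f\<in>M. w e \<le> w f"
      using that[of "arg_min_on w M"] arg_min_if_finite[OF fin M(2), of w]
      by (simp add: Ball_def Bex_def not_less)
    have "(\<Sum>f\<in>M. indicator (pyramid G M f) w :: ennreal)
        = (\<Sum>f\<in>M. if f = e then indicator (matching_polytope G) w else 0)"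
    proof (rule sum.cong[OF refl])
      fix f assume "f \<in> M"
      then show "indicator (pyramid G M f) w = (if f = e then indicator (matching_polytope G) w else 0 :: ennreal)"
      proof (cases "f = e")
        case True
        then show ?thesis using e by (simp add: pyramid_def indicator_def)
      next
        case False
        then have "w e < w f" using e inj \<open>f \<in> M\<close> by (simp add: less_le)
        then have "w \<notin> pyramid G M f" using e by (auto simp: pyramid_def not_le)
        then show ?thesis using False by simp
      qed
    qed
    also have "\<dots> = indicator (matching_polytope G) w"
      using fin e by simp
    finally show "indicator (matching_polytope G) w = (\<Sum>e\<in>M. indicator (pyramid G M e) w :: ennreal)" ..
  qed
  have "emeasure ?L (matching_polytope G) = (\<integral>\<^sup>+ w. indicator (matching_polytope G) w \<partial>?L)"
    using matching_polytope_sets[OF G] by simp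
  also have "\<dots> = (\<integral>\<^sup>+ w. (\<Sum>e\<in>M. indicator (pyramid G M e) w) \<partial>?L)"
    by (rule nn_integral_cong_AE[OF AE])
  also have "\<dots> = (\<Sum>e\<in>M. \<integral>\<^sup>+ w. indicator (pyramid G M e) w \<partial>?L)"
    using pyramid_sets[OF G M(1)] by (intro nn_integral_sum) auto
  also have "\<dots> = (\<Sum>e\<in>M. emeasure ?L (pyramid G M e))"
    using pyramid_sets[OF G M(1)] by (intro sum.cong) auto
  finally show ?thesis .
qed

theorem proposition2p6:
  fixes G :: "'a ugraph" and M :: "'a set set"
  assumes "finite_simple_graph G"
    and "bipartite G"
    and "edges G \<noteq> {}"
    and "\<not> (\<exists>v. isolated_vertex G v)"
    and "almost_perfect_matching G M"
  shows "normalized_volume G = (\<Sum>e\<in>M. normalized_volume (delete_edge G e))"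
proof -
  let ?L = "\<lambda>I. Pi\<^sub>M I (\<lambda>_. lborel :: real measure)"
  let ?n = "card (edges G)"
  note G = assms(1) and M = assms(5)
  have ME: "M \<subseteq> edges G"
    using M by (auto simp: almost_perfect_matching_def matching_def)
  have n: "0 < ?n" using assms(3) finite_edges[OF G] by (simp add: card_gt_0_iff)
  \<comment> \<open>Any vertex is covered or has a covered neighbour, so one vertex is enough to make \<open>M\<close> nonempty.\<close>
  obtain v where "v \<in> verts G"
    using G assms(3) by (fastforce simp: finite_simple_graph_def card_2_iff)
  then have "M \<noteq> {}"
    using uncovered_vertex_neighbour[OF G M] by blast
  define V where "V e = measure (?L (edges G - {e})) (matching_polytope (delete_edge G e))" for e
  have V: "emeasure (?L (edges G - {e})) (matching_polytope (delete_edge G e)) = ennreal (V e)" for e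
    using emeasure_matching_polytope_finite[OF finite_simple_graph_delete_edge[OF G], of e]
    by (simp add: V_def delete_edge_def emeasure_eq_ennreal_measure)
  have V0: "0 \<le> V e" for e by (simp add: V_def)
  have "emeasure (?L (edges G)) (matching_polytope G) = (\<Sum>e\<in>M. ennreal (V e / ?n))"
    unfolding emeasure_matching_polytope_eq_sum_pyramids[OF G ME \<open>M \<noteq> {}\<close>]
    using V0 by (intro sum.cong refl) (simp add: emeasure_pyramid[OF G M] V ennreal_mult'[symmetric])
  also have "\<dots> = ennreal ((\<Sum>e\<in>M. V e) / ?n)"
    using V0 by (simp add: sum_divide_distrib sum_ennreal)
  finally have vol: "measure (?L (edges G)) (matching_polytope G) = (\<Sum>e\<in>M. V e) / ?n"
    using V0 by (simp add: measure_def sum_nonneg)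
  have "normalized_volume G = fact (?n - 1) * (\<Sum>e\<in>M. V e)"
    using n by (simp add: normalized_volume_def vol fact_reduce[of ?n])
  also have "\<dots> = (\<Sum>e\<in>M. fact (?n - 1) * V e)"
    by (rule sum_distrib_left)
  also have "\<dots> = (\<Sum>e\<in>M. normalized_volume (delete_edge G e))"
    using ME finite_edges[OF G]
    by (intro sum.cong) (auto simp: normalized_volume_def delete_edge_def V_def card_Diff_singleton)
  finally show ?thesis .
qed

end
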